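(* Let $C_0$ be a finite family of columns (over $\mathbb F_2$, with a common row set) each having support size at least two. If the bipartite incidence graph of $C_0$ is a forest, then the columns of $C_0$ are linearly independent and admit acyclic pivots.
   Context: The support $\operatorname{Supp}(c)$ of a column $c$ over $\mathbb F_2$ is the set of rows where its entry is one. The bipartite incidence graph of a family of (labelled) columns has as vertices the columns and the rows, with an edge between $c$ and $r$ when $r\in\operatorname{Supp}(c)$. The family $C_0$ admits acyclic pivots if one can choose distinct rows $p(c)\in\operatorname{Supp}(c)$, $c\in C_0$, such that the directed graph on rows with arrows $r\to p(c)$ for all $c\in C_0$ and $r\in\operatorname{Supp}(c)\setminus\{p(c)\}$ has no directed cycle. *)

theory Defs
  imports Complex_Main "HOL-Library.Z2" "HOL-Library.Function_Algebras"
begin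

text \<open>
  The row set is the type \<open>'r\<close>, which may be infinite. A column is a function from rows to
  \<open>bit\<close>, the two-element field. A family of labelled columns is given by a set \<open>I\<close> of labels
  and a map \<open>col\<close>; distinct labels may carry the same column.
\<close>

definition Supp :: "('r \<Rightarrow> bit) \<Rightarrow> 'r set" where
  "Supp c = {r. c r = 1}"

definition scale_col :: "bit \<Rightarrow> ('r \<Rightarrow> bit) \<Rightarrow> 'r \<Rightarrow> bit" where
  "scale_col a c = (\<lambda>r. a * c r)"

global_interpretation column: vector_space scale_col
  by unfold_locales (auto simp: scale_col_def fun_eq_iff algebra_simps)

text \<open>The library's \<open>independent\<close> concerns sets of vectors; injectivity makes a family that
  repeats a column dependent.\<close>

definition independent_family :: "'i set \<Rightarrow> ('i \<Rightarrow> 'r \<Rightarrow> bit) \<Rightarrow> bool" where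
  "independent_family I col \<longleftrightarrow> inj_on col I \<and> column.independent (col ` I)"

definition incidence_verts :: "'i set \<Rightarrow> ('i + 'r) set" where
  "incidence_verts I = Inl ` I \<union> range Inr"

definition incidence_edges :: "'i set \<Rightarrow> ('i \<Rightarrow> 'r \<Rightarrow> bit) \<Rightarrow> ('i + 'r) set set" where
  "incidence_edges I col = {{Inl c, Inr r} | c r. c \<in> I \<and> r \<in> Supp (col c)}"

text \<open>A cycle is listed without repeating its first vertex at the end.\<close>

definition is_cycle :: "'v set \<Rightarrow> 'v set set \<Rightarrow> 'v list \<Rightarrow> bool" where
  "is_cycle V E vs \<longleftrightarrow> 3 \<le> length vs \<and> distinct vs \<and> set vs \<subseteq> V \<and>
     (\<forall>k < length vs. {vs ! k, vs ! (Suc k mod length vs)} \<in> E)"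

definition is_forest :: "'v set \<Rightarrow> 'v set set \<Rightarrow> bool" where
  "is_forest V E \<longleftrightarrow> (\<nexists>vs. is_cycle V E vs)"

definition pivot_arrows :: "'i set \<Rightarrow> ('i \<Rightarrow> 'r \<Rightarrow> bit) \<Rightarrow> ('i \<Rightarrow> 'r) \<Rightarrow> ('r \<times> 'r) set" where
  "pivot_arrows I col p = {(r, p c) | c r. c \<in> I \<and> r \<in> Supp (col c) - {p c}}"

definition admits_acyclic_pivots :: "'i set \<Rightarrow> ('i \<Rightarrow> 'r \<Rightarrow> bit) \<Rightarrow> bool" where
  "admits_acyclic_pivots I col \<longleftrightarrow>
     (\<exists>p. inj_on p I \<and> (\<forall>c\<in>I. p c \<in> Supp (col c)) \<and> acyclic (pivot_arrows I col p))"

end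

theory Submission
  imports Defs
begin

text \<open>
  Everything follows from one fact about forests: a nonempty subfamily has a column \<open>c\<close> with a
  \<^emph>\<open>private\<close> row, one that lies in \<open>Supp (col c)\<close> and in no other support
  (\<open>forest_private_row\<close>). A private row is a leaf of the incidence graph. A leaf exists because
  otherwise one could walk forever without backtracking; supports may be infinite, but every edge
  touches one of the finitely many columns, so the walk revisits a vertex, and a shortest return
  is a cycle (\<open>forest_has_leaf\<close>). The leaf is a row and not a column because supports have at
  least two elements.

  Peeling off such a column \<open>c\<close> with private row \<open>r\<close> gives both conclusions by induction. The
  other columns vanish at \<open>r\<close> and hence so does their span, while \<open>col c\<close> does not
  (\<open>independent_family_insert\<close>). Taking \<open>r\<close> as the pivot of \<open>c\<close> only adds arrows into \<open>r\<close>, and no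
  arrow leaves \<open>r\<close>, so no directed cycle is created (\<open>admits_acyclic_pivots_insert\<close>).
\<close>

section \<open>Leaves of forests\<close>

text \<open>The closed piece of walk with the fewest steps has no inner repetition. It has at least
  three steps because consecutive vertices differ and the walk does not backtrack.\<close>

lemma nonbacktracking_walk_cycle:
  fixes v :: "nat \<Rightarrow> 'v"
  assumes edge: "\<And>n. {v n, v (Suc n)} \<in> E"
    and vert: "\<And>n. v n \<in> V"
    and no_loop: "\<And>n. v n \<noteq> v (Suc n)"
    and no_back: "\<And>n. v n \<noteq> v (Suc (Suc n))"
    and not_inj: "\<not> inj v"
  shows "\<exists>vs. is_cycle V E vs"
proof -
  define returns where "returns d \<longleftrightarrow> 0 < d \<and> (\<exists>i. v i = v (i + d))" for d
  have "\<exists>d. returns d"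
  proof -
    obtain i j where "i < j" "v i = v j"
      using not_inj by (metis injI linorder_neqE_nat)
    then have "returns (j - i)"
      by (auto simp: returns_def intro!: exI[of _ i])
    then show ?thesis ..
  qed
  define d where "d = (LEAST d. returns d)"
  have "returns d"
    unfolding d_def using \<open>\<exists>d. returns d\<close> by (rule LeastI_ex)
  then obtain i where i: "0 < d" "v i = v (i + d)"
    by (auto simp: returns_def)
  have minimal: "v a \<noteq> v b" if "a < b" "b < a + d" for a b
  proof
    assume "v a = v b"
    with that have "returns (b - a)"
      by (auto simp: returns_def intro!: exI[of _ a])
    then have "d \<le> b - a"
      unfolding d_def by (rule Least_le)
    with that show False
      by linarith
  qed
  have "d \<noteq> 1" "d \<noteq> 2"
    using i no_loop[of i] no_back[of i] by (auto simp: numeral_2_eq_2)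
  with i have "3 \<le> d"
    by linarith
  let ?vs = "map (\<lambda>k. v (i + k)) [0..<d]"
  have nth: "?vs ! k = v (i + k)" if "k < d" for k
    using that by simp
  have "inj_on (\<lambda>k. v (i + k)) {0..<d}"
  proof (rule inj_onI)
    fix a b assume "a \<in> {0..<d}" "b \<in> {0..<d}" "v (i + a) = v (i + b)"
    then show "a = b"
      using minimal[of "i + a" "i + b"] minimal[of "i + b" "i + a"]
      by (cases a b rule: linorder_cases) auto
  qed
  then have "distinct ?vs"
    by (simp add: distinct_map)
  moreover have "{?vs ! k, ?vs ! (Suc k mod length ?vs)} \<in> E" if "k < length ?vs" for k
  proof (cases "Suc k = d")
    case True
    then have "Suc k mod length ?vs = 0" "v (Suc (i + k)) = v i"
      using i by auto
    then show ?thesis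
      using edge[of "i + k"] nth[of k] nth[of 0] i(1) that
      by (simp del: upt_Suc)
  next
    case False
    then show ?thesis
      using edge[of "i + k"] that by simp
  qed
  ultimately have "is_cycle V E ?vs"
    using \<open>3 \<le> d\<close> vert by (auto simp: is_cycle_def)
  then show ?thesis ..
qed

text \<open>Finiteness enters only through a finite vertex cover \<open>F\<close>: of any two consecutive vertices
  of a walk one lies in \<open>F\<close>, so an infinite walk cannot be injective.\<close>

lemma forest_has_leaf:
  assumes forest: "is_forest V E"
    and graph: "\<And>x y. {x, y} \<in> E \<Longrightarrow> x \<noteq> y \<and> x \<in> V"
    and cover: "finite F" "\<And>x y. {x, y} \<in> E \<Longrightarrow> x \<in> F \<or> y \<in> F"
    and start: "{x0, y0} \<in> E"
  shows "\<exists>x y. {x, y} \<in> E \<and> (\<forall>z. {y, z} \<in> E \<longrightarrow> z = x)"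
proof (rule ccontr)
  assume "\<not> ?thesis"
  then have continue: "\<exists>z. {y, z} \<in> E \<and> z \<noteq> x" if "{x, y} \<in> E" for x y
    using that by blast
  \<comment> \<open>The state of the walk is the directed edge traversed last.\<close>
  have "\<exists>f :: nat \<Rightarrow> _. \<forall>n. {fst (f n), snd (f n)} \<in> E \<and>
      fst (f (Suc n)) = snd (f n) \<and> snd (f (Suc n)) \<noteq> fst (f n)"
  proof (rule dependent_nat_choice[of "\<lambda>_ a. {fst a, snd a} \<in> E"
        "\<lambda>_ a b. fst b = snd a \<and> snd b \<noteq> fst a"])
    show "\<exists>a. {fst a, snd a} \<in> E"
      using start by (intro exI[of _ "(x0, y0)"]) simp
    show "\<exists>b. {fst b, snd b} \<in> E \<and> fst b = snd a \<and> snd b \<noteq> fst a"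
      if "{fst a, snd a} \<in> E" for a
      using continue[OF that] by (metis fst_conv snd_conv)
  qed
  then obtain f :: "nat \<Rightarrow> _"
    where f: "\<And>n. {fst (f n), snd (f n)} \<in> E" "\<And>n. fst (f (Suc n)) = snd (f n)"
      "\<And>n. snd (f (Suc n)) \<noteq> fst (f n)"
    by blast
  define v where "v n = fst (f n)" for n
  have edge: "{v n, v (Suc n)} \<in> E" for n
    using f by (simp add: v_def)
  have "\<not> inj v"
  proof
    assume "inj v"
    then have "finite (v -` F)"
      using cover(1) by (simp add: finite_vimageI)
    then have "finite (v -` F \<union> Suc -` (v -` F))"
      by (simp add: finite_vimageI)
    moreover have "v -` F \<union> Suc -` (v -` F) = UNIV"
      using cover(2)[OF edge] by auto
    ultimately show False
      by simp
  qed
  moreover have "v n \<noteq> v (Suc (Suc n))" for n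
    using f(3)[of n] by (simp add: v_def f(2))
  ultimately have "\<exists>vs. is_cycle V E vs"
    using edge graph by (intro nonbacktracking_walk_cycle[of v]) blast+
  with forest show False
    by (simp add: is_forest_def)
qed

section \<open>Private rows\<close>

lemma incidence_edges_iff [simp]:
  "{Inl c, Inr r} \<in> incidence_edges I col \<longleftrightarrow> c \<in> I \<and> r \<in> Supp (col c)"
  "{Inr r, Inl c} \<in> incidence_edges I col \<longleftrightarrow> c \<in> I \<and> r \<in> Supp (col c)"
  by (auto simp: incidence_edges_def doubleton_eq_iff)

lemma incidence_edgesE:
  assumes "{x, y} \<in> incidence_edges I col"
  obtains (col_row) c r where "x = Inl c" "y = Inr r" "c \<in> I" "r \<in> Supp (col c)"
    | (row_col) c r where "x = Inr r" "y = Inl c" "c \<in> I" "r \<in> Supp (col c)"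
  using assms by (auto simp: incidence_edges_def doubleton_eq_iff)

lemma is_forest_mono:
  assumes "is_forest V E" "V' \<subseteq> V" "E' \<subseteq> E"
  shows "is_forest V' E'"
proof -
  have "is_cycle V E vs" if "is_cycle V' E' vs" for vs
    using that assms(2,3) unfolding is_cycle_def by blast
  with assms(1) show ?thesis
    unfolding is_forest_def by blast
qed

lemma incidence_forest_subfamily:
  assumes "is_forest (incidence_verts I) (incidence_edges I col)" "J \<subseteq> I"
  shows "is_forest (incidence_verts J) (incidence_edges J col)"
proof (rule is_forest_mono[OF assms(1)])
  show "incidence_verts J \<subseteq> incidence_verts I"
    using assms(2) by (auto simp: incidence_verts_def)
  show "incidence_edges J col \<subseteq> incidence_edges I col"
    using assms(2) by (auto simp: incidence_edges_def)
qed

lemma ex_other_elem: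
  assumes "infinite S \<or> 2 \<le> card S"
  shows "\<exists>s\<in>S. s \<noteq> r"
proof (rule ccontr)
  assume "\<not> ?thesis"
  then have "S \<subseteq> {r}"
    by auto
  then have "finite S" "card S \<le> 1"
    using card_mono[of "{r}" S] finite_subset[of S "{r}"] by auto
  with assms show False
    by auto
qed

text \<open>A leaf of the incidence graph cannot be a column, which has at least two neighbours; and a
  row that is a leaf is private to its only neighbour.\<close>

lemma forest_private_row:
  assumes "finite I" "I \<noteq> {}"
    and big: "\<And>c. c \<in> I \<Longrightarrow> infinite (Supp (col c)) \<or> 2 \<le> card (Supp (col c))"
    and forest: "is_forest (incidence_verts I) (incidence_edges I col)"
  shows "\<exists>c\<in>I. \<exists>r\<in>Supp (col c). \<forall>c'\<in>I - {c}. r \<notin> Supp (col c')"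
proof -
  obtain c0 where "c0 \<in> I"
    using \<open>I \<noteq> {}\<close> by blast
  moreover obtain r0 where "r0 \<in> Supp (col c0)"
    using ex_other_elem[OF big[OF \<open>c0 \<in> I\<close>]] by blast
  ultimately have start: "{Inl c0, Inr r0} \<in> incidence_edges I col"
    by simp
  have "\<exists>x y. {x, y} \<in> incidence_edges I col \<and>
      (\<forall>z. {y, z} \<in> incidence_edges I col \<longrightarrow> z = x)"
  proof (rule forest_has_leaf[where F = "Inl ` I", OF forest _ _ _ start])
    show "finite (Inl ` I)"
      using \<open>finite I\<close> by simp
  qed (auto elim!: incidence_edgesE simp: incidence_verts_def)
  then obtain x y where xy: "{x, y} \<in> incidence_edges I col"
    and leaf: "\<And>z. {y, z} \<in> incidence_edges I col \<Longrightarrow> z = x"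
    by blast
  from xy show ?thesis
  proof (cases rule: incidence_edgesE)
    case (col_row c r)
    have "c' = c" if "c' \<in> I" "r \<in> Supp (col c')" for c'
      using leaf[of "Inl c'"] col_row that by simp
    with col_row show ?thesis
      by blast
  next
    case (row_col c r)
    obtain s where "s \<in> Supp (col c)" "s \<noteq> r"
      using ex_other_elem[OF big[OF \<open>c \<in> I\<close>]] by blast
    then have False
      using leaf[of "Inr s"] row_col by simp
    then show ?thesis ..
  qed
qed

section \<open>Adding a column with a private row\<close>

lemma span_vanishes_at:
  assumes "\<And>f. f \<in> S \<Longrightarrow> f r = 0" "g \<in> column.span S"
  shows "g r = 0"
proof -
  have "column.subspace {f. f r = 0}"
    by (auto simp: column.subspace_def scale_col_def)
  then have "column.span S \<subseteq> {f. f r = 0}"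
    using assms(1) by (intro column.span_minimal) auto
  with assms(2) show ?thesis
    by auto
qed

lemma independent_family_insert:
  assumes indep: "independent_family I col"
    and row: "r \<in> Supp (col c)" "\<And>c'. c' \<in> I \<Longrightarrow> r \<notin> Supp (col c')"
  shows "independent_family (insert c I) col"
proof -
  have "f r = 0" if "f \<in> col ` I" for f
    using that row(2) by (auto simp: Supp_def)
  moreover have "col c r \<noteq> 0"
    using row(1) by (simp add: Supp_def)
  ultimately have "col c \<notin> column.span (col ` I)"
    using span_vanishes_at by metis
  moreover from this have "col c \<notin> col ` I"
    using column.span_base by blast
  ultimately show ?thesis
    using indep by (auto simp: independent_family_def column.independent_insert)
qed

text \<open>A path can reach the sink \<open>r\<close> only in its last step.\<close>

lemma acyclic_add_arrows_into_sink:
  assumes "acyclic R" "S \<subseteq> UNIV \<times> {r}" "r \<notin> Domain (R \<union> S)"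
  shows "acyclic (R \<union> S)"
proof -
  have path: "y = r \<or> (x, y) \<in> R\<^sup>+" if "(x, y) \<in> (R \<union> S)\<^sup>+" for x y
    using that
  proof (induction rule: trancl_induct)
    case (base y)
    then show ?case
      using assms(2) by blast
  next
    case (step y z)
    have "y \<noteq> r"
      using step.hyps(2) assms(3) by blast
    with step.IH have "(x, y) \<in> R\<^sup>+"
      by blast
    with step.hyps(2) assms(2) show ?case
      by (blast intro: trancl_into_trancl)
  qed
  have "(x, x) \<notin> (R \<union> S)\<^sup>+" for x
  proof
    assume cyc: "(x, x) \<in> (R \<union> S)\<^sup>+"
    then have "x \<in> Domain (R \<union> S)"
      by (metis DomainI trancl_domain)
    with path[OF cyc] assms show False
      by (auto simp: acyclic_def)
  qed
  then show ?thesis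
    by (simp add: acyclic_def)
qed

lemma admits_acyclic_pivots_insert:
  assumes "admits_acyclic_pivots I col"
    and row: "r \<in> Supp (col c)" "\<And>c'. c' \<in> I \<Longrightarrow> r \<notin> Supp (col c')"
  shows "admits_acyclic_pivots (insert c I) col"
proof -
  obtain p where p: "inj_on p I" "\<And>c'. c' \<in> I \<Longrightarrow> p c' \<in> Supp (col c')"
      "acyclic (pivot_arrows I col p)"
    using assms(1) by (auto simp: admits_acyclic_pivots_def)
  have "c \<notin> I"
    using row by blast
  let ?q = "p(c := r)"
  let ?S = "{(s, r) | s. s \<in> Supp (col c) - {r}}"
  have arrows: "pivot_arrows (insert c I) col ?q = pivot_arrows I col p \<union> ?S"
    using \<open>c \<notin> I\<close> by (auto simp: pivot_arrows_def)
  have "r \<notin> Domain (pivot_arrows I col p \<union> ?S)"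
    using row(2) by (auto simp: pivot_arrows_def)
  then have "acyclic (pivot_arrows (insert c I) col ?q)"
    unfolding arrows by (intro acyclic_add_arrows_into_sink[OF p(3)]) auto
  moreover have "inj_on ?q (insert c I)"
    using p(1,2) row(2) \<open>c \<notin> I\<close> by (auto simp: inj_on_def)
  moreover have "\<forall>c'\<in>insert c I. ?q c' \<in> Supp (col c')"
    using p(2) row(1) by auto
  ultimately show ?thesis
    unfolding admits_acyclic_pivots_def by blast
qed

section \<open>Forests of columns\<close>

theorem proposition4p5:
  fixes C0 :: "'i set" and col :: "'i \<Rightarrow> 'r \<Rightarrow> bit"
  assumes "finite C0"
    and "\<And>c. c \<in> C0 \<Longrightarrow> infinite (Supp (col c)) \<or> 2 \<le> card (Supp (col c))"
    and "is_forest (incidence_verts C0) (incidence_edges C0 col)"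
  shows "independent_family C0 col \<and> admits_acyclic_pivots C0 col"
  using assms(1)
proof (induction rule: finite_remove_induct)
  case empty
  show ?case
    by (simp add: independent_family_def admits_acyclic_pivots_def pivot_arrows_def acyclic_def
        column.independent_empty)
next
  case (remove I)
  have "\<exists>c\<in>I. \<exists>r\<in>Supp (col c). \<forall>c'\<in>I - {c}. r \<notin> Supp (col c')"
    using remove.hyps assms(2)
    by (intro forest_private_row incidence_forest_subfamily[OF assms(3)]) auto
  then obtain c r where "c \<in> I" and row: "r \<in> Supp (col c)"
      "\<And>c'. c' \<in> I - {c} \<Longrightarrow> r \<notin> Supp (col c')"
    by blast
  then have "independent_family (insert c (I - {c})) col"
      "admits_acyclic_pivots (insert c (I - {c})) col"
    using remove.IH[OF \<open>c \<in> I\<close>]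
    by (blast intro: independent_family_insert admits_acyclic_pivots_insert)+
  with \<open>c \<in> I\<close> show ?case
    by (simp add: insert_absorb)
qed

end
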